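(* For every odd integer $B\ge 3$, the numbers $(B^2+1)/2$ and $(B+1)^2/2$ are each fixed points of $S_B$.
   Context: Fix an integer $B\ge 2$. Every nonzero Gaussian integer $a+bi$ is written uniquely as $a+bi=\sum_{j=0}^n (a_j+b_ji)B^j$ with $a_j,b_j\in\mathbb{Z}$, $a_n,b_n$ not both $0$, and for each $j$: $|a_j|\le B-1$, $|b_j|\le B-1$, $\operatorname{sgn}(a)a_j\ge 0$, $\operatorname{sgn}(b)b_j\ge 0$. The Gaussian $B$-happy function $S_B:\mathbb{Z}[i]\to\mathbb{Z}[i]$ is defined by $S_B(0)=0$ and $S_B(a+bi)=\sum_{j=0}^n (a_j+b_ji)^2$. (On positive rational integers this is the sum of the squares of the base-$B$ digits.) *)

theory Defs
  imports Complex_Main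
begin

definition gaussian_ints :: "complex set" where
  "gaussian_ints = {z. Re z \<in> \<int> \<and> Im z \<in> \<int>}"

text \<open>
  \<open>gauss_expansion B z n a b\<close>: the digits \<open>a j + b j \<i>\<close>, for \<open>j \<le> n\<close>, form the base-\<open>B\<close> expansion
  of \<open>z\<close>. The values of \<open>a\<close> and \<open>b\<close> beyond \<open>n\<close> are irrelevant.
\<close>

definition gauss_expansion ::
    "int \<Rightarrow> complex \<Rightarrow> nat \<Rightarrow> (nat \<Rightarrow> int) \<Rightarrow> (nat \<Rightarrow> int) \<Rightarrow> bool" where
  "gauss_expansion B z n a b \<longleftrightarrow>
     z = (\<Sum>j\<le>n. Complex (of_int (a j)) (of_int (b j)) * of_int B ^ j) \<and>
     \<not> (a n = 0 \<and> b n = 0) \<and>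
     (\<forall>j\<le>n. \<bar>a j\<bar> \<le> B - 1 \<and> \<bar>b j\<bar> \<le> B - 1 \<and>
            sgn (Re z) * of_int (a j) \<ge> 0 \<and> sgn (Im z) * of_int (b j) \<ge> 0)"

text \<open>
  Only meaningful for \<open>B \<ge> 2\<close> and \<open>z \<in> gaussian_ints\<close>; the description is then well defined by
  \<open>gauss_expansion_exists\<close> and \<open>gauss_expansion_unique\<close> below.
\<close>

definition gauss_happy :: "int \<Rightarrow> complex \<Rightarrow> complex" where
  "gauss_happy B z =
     (if z = 0 then 0
      else (THE w. \<exists>n a b. gauss_expansion B z n a b \<and>
                   w = (\<Sum>j\<le>n. (Complex (of_int (a j)) (of_int (b j)))\<^sup>2)))"

lemma digits_zero:
  fixes B :: int
  assumes "B \<ge> 2" "(\<Sum>j<N. d j * B ^ j) = 0" "\<And>j. j < N \<Longrightarrow> \<bar>d j\<bar> \<le> B - 1" "j < N"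
  shows "d j = 0"
  using assms(2-)
proof (induction N arbitrary: d j)
  case 0
  then show ?case by simp
next
  case (Suc N)
  have eq: "d 0 + B * (\<Sum>j<N. d (Suc j) * B ^ j) = 0"
    using Suc.prems(1) by (subst (asm) sum.lessThan_Suc_shift) (simp add: sum_distrib_left ac_simps)
  then have "d 0 = B * (- (\<Sum>j<N. d (Suc j) * B ^ j))"
    by simp
  then have "B dvd d 0" by (metis dvd_triv_left)
  moreover have "\<bar>d 0\<bar> < \<bar>B\<bar>" using Suc.prems(2)[of 0] assms(1) by simp
  ultimately have d0: "d 0 = 0" by (meson dvd_imp_le_int linorder_not_less)
  then have "(\<Sum>j<N. d (Suc j) * B ^ j) = 0" using eq assms(1) by simp
  from Suc.IH[OF this] Suc.prems(2,3) d0 show ?case by (cases j) auto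
qed

lemma signed_digits_unique:
  fixes B :: int and s :: real
  assumes B: "B \<ge> 2" and s: "s = sgn (of_int x)"
    and c: "(\<Sum>j<N. c j * B ^ j) = x" "\<And>j. \<bar>c j\<bar> \<le> B - 1" "\<And>j. s * of_int (c j) \<ge> 0"
    and d: "(\<Sum>j<N. d j * B ^ j) = x" "\<And>j. \<bar>d j\<bar> \<le> B - 1" "\<And>j. s * of_int (d j) \<ge> 0"
    and j: "j < N"
  shows "c j = d j"
proof (cases "x = 0")
  case True
  then show ?thesis
    using digits_zero[OF B, of c N j] digits_zero[OF B, of d N j] c(1,2) d(1,2) j by simp
next
  case False
  have "(\<Sum>j<N. (c j - d j) * B ^ j) = 0"
    using c(1) d(1) by (simp add: left_diff_distrib sum_subtractf)
  moreover have "\<bar>c i - d i\<bar> \<le> B - 1" for i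
    using c(2,3)[of i] d(2,3)[of i] s False by (auto simp: sgn_real_def split: if_splits)
  ultimately show ?thesis
    using digits_zero[OF B, of "\<lambda>j. c j - d j" N j] j by simp
qed

lemma sum_Complex:
  "(\<Sum>j\<in>A. Complex (of_int (a j)) (of_int (b j)) * of_int B ^ j) =
     Complex (of_int (\<Sum>j\<in>A. a j * B ^ j)) (of_int (\<Sum>j\<in>A. b j * B ^ j))"
  by (simp add: complex_eq_iff flip: of_int_power)

lemma sum_extend:
  fixes a :: "nat \<Rightarrow> int"
  assumes "n < N"
  shows "(\<Sum>j<N. (if j \<le> n then a j else 0) * B ^ j) = (\<Sum>j\<le>n. a j * B ^ j)"
  using assms by (intro sum.mono_neutral_cong_right) auto

lemma gauss_expansion_unique:
  assumes B: "B \<ge> 2" and e: "gauss_expansion B z n a b" and e': "gauss_expansion B z m c d"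
  shows "n = m" and "j \<le> n \<Longrightarrow> a j = c j" and "j \<le> n \<Longrightarrow> b j = d j"
proof -
  define N where "N = Suc (max n m)"
  define ext :: "nat \<Rightarrow> (nat \<Rightarrow> int) \<Rightarrow> nat \<Rightarrow> int"
    where "ext k f j = (if j \<le> k then f j else 0)" for k f j
  define x where "x = (\<Sum>j\<le>n. a j * B ^ j)"
  define y where "y = (\<Sum>j\<le>n. b j * B ^ j)"
  have N: "n < N" "m < N" by (auto simp: N_def)
  have z: "z = Complex (of_int x) (of_int y)"
    using e unfolding gauss_expansion_def sum_Complex x_def y_def by blast
  have "z = Complex (of_int (\<Sum>j\<le>m. c j * B ^ j)) (of_int (\<Sum>j\<le>m. d j * B ^ j))"
    using e' unfolding gauss_expansion_def sum_Complex by blast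
  with z have x': "(\<Sum>j\<le>m. c j * B ^ j) = x" and y': "(\<Sum>j\<le>m. d j * B ^ j) = y"
    by (simp_all del: of_int_sum)
  have dn: "\<bar>a j\<bar> \<le> B - 1" "\<bar>b j\<bar> \<le> B - 1" "sgn (of_int x :: real) * of_int (a j) \<ge> 0"
      "sgn (of_int y :: real) * of_int (b j) \<ge> 0" if "j \<le> n" for j
    using e that z unfolding gauss_expansion_def by (metis complex.sel)+
  have dm: "\<bar>c j\<bar> \<le> B - 1" "\<bar>d j\<bar> \<le> B - 1" "sgn (of_int x :: real) * of_int (c j) \<ge> 0"
      "sgn (of_int y :: real) * of_int (d j) \<ge> 0" if "j \<le> m" for j
    using e' that z unfolding gauss_expansion_def by (metis complex.sel)+
  have ac: "ext n a j = ext m c j" if "j < N" for j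
  proof (rule signed_digits_unique[OF B refl, where N = N and x = x])
    show "(\<Sum>j<N. ext n a j * B ^ j) = x" "(\<Sum>j<N. ext m c j * B ^ j) = x"
      unfolding ext_def using N x' by (simp_all add: sum_extend x_def)
  qed (use dn dm B that in \<open>auto simp: ext_def\<close>)
  have bd: "ext n b j = ext m d j" if "j < N" for j
  proof (rule signed_digits_unique[OF B refl, where N = N and x = y])
    show "(\<Sum>j<N. ext n b j * B ^ j) = y" "(\<Sum>j<N. ext m d j * B ^ j) = y"
      unfolding ext_def using N y' by (simp_all add: sum_extend y_def)
  qed (use dn dm B that in \<open>auto simp: ext_def\<close>)
  have nz: "\<not> (a n = 0 \<and> b n = 0)" "\<not> (c m = 0 \<and> d m = 0)"
    using e e' by (auto simp: gauss_expansion_def)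
  show nm: "n = m"
    using ac[of n] bd[of n] ac[of m] bd[of m] nz N
    by (cases n m rule: linorder_cases) (auto simp: ext_def)
  show "a j = c j" "b j = d j" if "j \<le> n"
    using ac[of j] bd[of j] that nm N by (auto simp: ext_def)
qed

lemma sum_digits_mod:
  fixes B m :: int
  assumes "B \<ge> 2" "m \<ge> 0"
  shows "(\<Sum>j<N. (m div B ^ j mod B) * B ^ j) = m mod B ^ N"
proof (induction N)
  case (Suc N)
  have "m mod (B ^ N * B) = B ^ N * (m div B ^ N mod B) + m mod B ^ N"
    using assms by (intro zmod_zmult2_eq) simp
  with Suc show ?case by (simp add: ac_simps)
qed simp

lemma gauss_expansion_exists:
  assumes B: "B \<ge> 2" and z: "z \<in> gaussian_ints" "z \<noteq> 0"
  shows "\<exists>n a b. gauss_expansion B z n a b"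
proof -
  obtain x y :: int where xy: "z = Complex (of_int x) (of_int y)"
    using z(1) by (auto simp: gaussian_ints_def complex_eq_iff elim!: Ints_cases)
  define dig :: "int \<Rightarrow> nat \<Rightarrow> int" where "dig u j = sgn u * (\<bar>u\<bar> div B ^ j mod B)" for u j
  define N where "N = nat (\<bar>x\<bar> + \<bar>y\<bar>)"
  have pow: "int k < B ^ k" for k
  proof -
    have "int k < 2 ^ k" using of_nat_less_two_power by blast
    also have "\<dots> \<le> B ^ k" using B by (intro power_mono) auto
    finally show ?thesis .
  qed
  have big: "\<bar>u\<bar> < B ^ k" if "u = x \<or> u = y" "k \<ge> N" for u k
    using pow[of k] that by (auto simp: N_def)
  have dig0: "dig u k = 0" if "u = x \<or> u = y" "k \<ge> N" for u k
    using big[OF that] by (simp add: dig_def)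
  have dsum: "(\<Sum>j<N. dig u j * B ^ j) = u" if "u = x \<or> u = y" for u
  proof -
    have "(\<Sum>j<N. dig u j * B ^ j) = sgn u * (\<Sum>j<N. (\<bar>u\<bar> div B ^ j mod B) * B ^ j)"
      by (simp add: dig_def sum_distrib_left ac_simps)
    also have "\<dots> = sgn u * \<bar>u\<bar>"
      using big[OF that, of N] B by (subst sum_digits_mod) auto
    finally show ?thesis by (simp add: sgn_mult_abs)
  qed
  define P where "P j \<longleftrightarrow> dig x j \<noteq> 0 \<or> dig y j \<noteq> 0" for j
  have bound: "\<forall>j. P j \<longrightarrow> j \<le> N"
    using dig0 by (metis P_def nle_le)
  have ex: "\<exists>j. P j"
  proof (rule ccontr)
    assume "\<nexists>j. P j"
    then have "x = 0" "y = 0" using dsum[of x] dsum[of y] by (auto simp: P_def)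
    with xy z(2) show False by (simp add: complex_eq_iff)
  qed
  define n where "n = (GREATEST j. P j)"
  have Pn: "P n" unfolding n_def using ex bound by (metis GreatestI_nat)
  have above: "\<not> P j" if "j > n" for j
    using that Greatest_le_nat[of P j N] bound unfolding n_def by fastforce
  have nN: "n < N" using Pn dig0 by (metis P_def not_le)
  have dsum': "(\<Sum>j\<le>n. dig u j * B ^ j) = u" if "u = x \<or> u = y" for u
  proof -
    have "dig u j = 0" if "j > n" for j
      using above[OF that] \<open>u = x \<or> u = y\<close> by (auto simp: P_def)
    then have "(\<Sum>j<N. dig u j * B ^ j) = (\<Sum>j\<le>n. dig u j * B ^ j)"
      using nN by (intro sum.mono_neutral_right) auto
    with dsum[OF that] show ?thesis by simp
  qed
  have digit: "0 \<le> k mod B" "k mod B \<le> B - 1" for k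
    using B pos_mod_bound[of B k] by auto
  have "\<bar>dig u j\<bar> \<le> B - 1" "sgn (of_int u :: real) * of_int (dig u j) \<ge> 0" for u j
    using digit[of "\<bar>u\<bar> div B ^ j"] B by (auto simp: dig_def sgn_if abs_mult)
  then have "gauss_expansion B z n (dig x) (dig y)"
    using dsum' Pn unfolding gauss_expansion_def sum_Complex
    by (auto simp: xy P_def simp del: of_int_sum)
  then show ?thesis by blast
qed

lemma gauss_happy_eq:
  assumes "B \<ge> 2" "z \<noteq> 0" "gauss_expansion B z n a b"
  shows "gauss_happy B z = (\<Sum>j\<le>n. (Complex (of_int (a j)) (of_int (b j)))\<^sup>2)"
proof -
  have "(THE w. \<exists>n a b. gauss_expansion B z n a b \<and>
           w = (\<Sum>j\<le>n. (Complex (of_int (a j)) (of_int (b j)))\<^sup>2))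
        = (\<Sum>j\<le>n. (Complex (of_int (a j)) (of_int (b j)))\<^sup>2)"
  proof (rule the_equality)
    fix w
    assume "\<exists>n a b. gauss_expansion B z n a b \<and>
              w = (\<Sum>j\<le>n. (Complex (of_int (a j)) (of_int (b j)))\<^sup>2)"
    then obtain m c d where e: "gauss_expansion B z m c d"
      and w: "w = (\<Sum>j\<le>m. (Complex (of_int (c j)) (of_int (d j)))\<^sup>2)"
      by blast
    show "w = (\<Sum>j\<le>n. (Complex (of_int (a j)) (of_int (b j)))\<^sup>2)"
      using gauss_expansion_unique[OF assms(1) e assms(3)] unfolding w by (auto intro!: sum.cong)
  qed (use assms(3) in blast)
  with assms(2) show ?thesis by (simp add: gauss_happy_def)
qed

lemma gauss_happy_in_gaussian_ints:
  assumes "B \<ge> 2" "z \<in> gaussian_ints"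
  shows "gauss_happy B z \<in> gaussian_ints"
proof (cases "z = 0")
  case True
  then show ?thesis by (simp add: gauss_happy_def gaussian_ints_def)
next
  case False
  then obtain n a b where "gauss_expansion B z n a b"
    using gauss_expansion_exists assms by blast
  then show ?thesis
    using gauss_happy_eq[OF assms(1) False]
    by (auto simp: gaussian_ints_def power2_eq_square intro!: Ints_sum)
qed

end

theory Submission
  imports Defs
begin

text \<open>
  Write \<open>B = 2k + 1\<close>. The two numbers have the two-digit expansions \<open>k B + (k + 1)\<close> and
  \<open>(k + 1) B + (k + 1)\<close>, and they equal \<open>k\<^sup>2 + (k + 1)\<^sup>2\<close> and \<open>2 (k + 1)\<^sup>2\<close> respectively.
\<close>

text \<open>Units digit \<open>c\<close>, leading digit \<open>d\<close> and zero imaginary digits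
  form an expansion, since \<open>0 < d\<close> keeps the leading digit nonzero; by uniqueness of
  expansions it determines the value.\<close>

lemma gauss_happy_two_digits:
  fixes B c d :: int
  assumes "0 \<le> c" "c < B" "0 < d" "d < B"
  shows "gauss_happy B (of_int (c + d * B)) = of_int (c\<^sup>2 + d\<^sup>2)"
proof -
  let ?a = "\<lambda>j::nat. if j = 0 then c else d"
  have pos: "c + d * B > 0"
    using assms by (simp add: add_nonneg_pos)
  \<comment> \<open>The digit sign condition uses \<open>sgn\<close> of a real part, so positivity
    is needed over the reals.\<close>
  then have "real_of_int c + real_of_int d * real_of_int B > 0"
    by (metis of_int_0_less_iff of_int_add of_int_mult)
  then have "gauss_expansion B (of_int (c + d * B)) 1 ?a (\<lambda>_. 0)"
    using assms by (auto simp: gauss_expansion_def complex_eq_iff sgn_if)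
  moreover have "B \<ge> 2"
    using assms by linarith
  moreover have "(of_int (c + d * B) :: complex) \<noteq> 0"
    using pos by (metis less_irrefl of_int_eq_0_iff)
  ultimately show ?thesis
    using gauss_happy_eq[of B "of_int (c + d * B)" 1 ?a "\<lambda>_. 0"]
    by (simp add: complex_eq_iff power2_eq_square)
qed

lemma two_digit_fixed_point:
  fixes B c d :: int
  assumes "0 \<le> c" "c < B" "0 < d" "d < B" and "c + d * B = c\<^sup>2 + d\<^sup>2"
  shows "of_int (c + d * B) \<in> {z \<in> gaussian_ints. gauss_happy B z = z}"
  using gauss_happy_two_digits[OF assms(1-4)] assms(5)
  \<comment> \<open>With \<open>of_int\<close> kept outside, the integer equation rewrites its
    argument.\<close>
  by (simp add: gaussian_ints_def del: of_int_add of_int_mult of_int_power)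

theorem theorem7:
  fixes B :: int
  assumes "odd B" and "B \<ge> 3"
  shows "(of_int B ^ 2 + 1) / 2 \<in> {z \<in> gaussian_ints. gauss_happy B z = z} \<and>
         (of_int B + 1) ^ 2 / 2 \<in> {z \<in> gaussian_ints. gauss_happy B z = z}"
proof -
  obtain k where B: "B = 2 * k + 1"
    using assms(1) by (elim oddE)
  with assms(2) have k: "k \<ge> 1"
    by simp
  have "(of_int B ^ 2 + 1) / 2 = (of_int ((k + 1) + k * B) :: complex)"
    and "(of_int B + 1) ^ 2 / 2 = (of_int ((k + 1) + (k + 1) * B) :: complex)"
    by (simp_all add: B power2_eq_square field_simps)
  \<comment> \<open>Here \<open>k \<ge> 1\<close> gives both \<open>k + 1 < B\<close> and a positive
    leading digit \<open>k\<close>.\<close>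
  moreover have "of_int ((k + 1) + k * B) \<in> {z \<in> gaussian_ints. gauss_happy B z = z}"
    and "of_int ((k + 1) + (k + 1) * B) \<in> {z \<in> gaussian_ints. gauss_happy B z = z}"
    using k by (intro two_digit_fixed_point; simp add: B power2_eq_square algebra_simps)+
  ultimately show ?thesis
    by (simp only: simp_thms)
qed

end
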